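(* Let $X$ be a finite nonempty set of keys, $\Sigma$ a set, $q\ge1$ and $m\ge0$ integers, $\mathcal{H}=\{h_x:\Sigma\to[2^q]\}_{x\in X}$ any family of functions, and $\sigma:\{0,\dots,q-1\}\times\{0,\dots,m\}\to\Sigma$ injective. Define $\tilde f$ and FlipHash $f$ as in the context. Then $f$ is monotone: for all $x\in X$ and all $n,n'\in\{1,\dots,2^q\}$ with $n<n'$, if $f(x,n')<n$ then $f(x,n')=f(x,n)$.
   Context: $[N]=\{0,\dots,N-1\}$; $\oplus$ is bitwise XOR. For $x\in X$, $r\in\{0,\dots,q\}$: $\tilde f(x,2^r)$ is computed as $a= h_x(\sigma(0,0))\bmod 2^r$; $b=\lfloor\log_2 a\rfloor$ if $a>0$, else $b=0$; $c=h_x(\sigma(b,0))\bmod 2^b$; $\tilde f(x,2^r)=a\oplus c$. For $x\in X$ and $n\in\{1,\dots,2^q\}$, $f(x,n)\in[n]$ is computed as: let $r=\lceil\log_2 n\rceil$ and $d=\tilde f(x,2^r)$. If $d<n$, return $d$ (A). Otherwise, for $i=1,\dots,m$ in order: let $e_i=h_x(\sigma(r-1,i))\bmod 2^r$; if $e_i<2^{r-1}$, return $\tilde f(x,2^{r-1})$ (B); else if $e_i<n$, return $e_i$ (C); else continue. If the loop finishes without returning, return $\tilde f(x,2^{r-1})$ (D). *)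

theory Defs
  imports Complex_Main "HOL-Library.FuncSet"
begin

text \<open>
  A hash family is a function \<open>h\<close> with \<open>h x s\<close> standing for \<open>h\<^sub>x(s)\<close>, and \<open>\<sigma>\<close> takes
  pairs. The argument \<open>N\<close> below is only ever a power of two, \<open>N = 2 ^ r\<close>.
\<close>

definition flip_tilde ::
  "('k \<Rightarrow> 's \<Rightarrow> nat) \<Rightarrow> (nat \<times> nat \<Rightarrow> 's) \<Rightarrow> 'k \<Rightarrow> nat \<Rightarrow> nat" where
  "flip_tilde h \<sigma> x N =
    (let a = h x (\<sigma> (0, 0)) mod N;
         b = (if a > 0 then nat \<lfloor>log 2 (real a)\<rfloor> else 0);
         c = h x (\<sigma> (b, 0)) mod 2 ^ b
     in Bit_Operations.xor a c)"

text \<open>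
  The loop over the remaining indices \<open>i\<close>. It is entered only when \<open>r \<ge> 1\<close>: for \<open>n = 1\<close>
  one has \<open>r = 0\<close> and \<open>flip_tilde h \<sigma> x 1 = 0 < n\<close>. Hence the subtraction \<open>r - 1\<close> never
  truncates.
\<close>

fun flip_loop ::
  "('k \<Rightarrow> 's \<Rightarrow> nat) \<Rightarrow> (nat \<times> nat \<Rightarrow> 's) \<Rightarrow> 'k \<Rightarrow> nat \<Rightarrow> nat \<Rightarrow> nat list \<Rightarrow> nat" where
  "flip_loop h \<sigma> x n r [] = flip_tilde h \<sigma> x (2 ^ (r - 1))"
| "flip_loop h \<sigma> x n r (i # is) =
    (let e = h x (\<sigma> (r - 1, i)) mod 2 ^ r
     in if e < 2 ^ (r - 1) then flip_tilde h \<sigma> x (2 ^ (r - 1))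
        else if e < n then e
        else flip_loop h \<sigma> x n r is)"

definition flip_hash ::
  "('k \<Rightarrow> 's \<Rightarrow> nat) \<Rightarrow> (nat \<times> nat \<Rightarrow> 's) \<Rightarrow> nat \<Rightarrow> 'k \<Rightarrow> nat \<Rightarrow> nat" where
  "flip_hash h \<sigma> m x n =
    (let r = nat \<lceil>log 2 (real n)\<rceil>;
         d = flip_tilde h \<sigma> x (2 ^ r)
     in if d < n then d else flip_loop h \<sigma> x n r [1..<m + 1])"

end

theory Submission
  imports Defs
begin

text \<open>
  The value \<open>flip_tilde h \<sigma> x N\<close> is obtained from \<open>a = h x (\<sigma> (0, 0)) mod N\<close> by flipping bits below
  the leading bit of \<open>a\<close>, in a way that depends on \<open>a\<close> only. Hence it lies in the same dyadic
  interval \<open>[2 ^ b, 2 ^ (b + 1))\<close> as \<open>a\<close>, and if it is below \<open>2 ^ s\<close>, then so is \<open>a\<close>, which is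
  therefore unchanged when the modulus is reduced to \<open>2 ^ s\<close>: \<open>flip_tilde\<close> is monotone along powers
  of two. For sizes between \<open>2 ^ (r - 1)\<close> and \<open>2 ^ r\<close>, every loop result other than
  \<open>flip_tilde h \<sigma> x (2 ^ (r - 1))\<close> is at least \<open>2 ^ (r - 1)\<close>, and lowering \<open>n\<close> within this range only
  discards candidates that are at least the new \<open>n\<close>.
\<close>

lemma xor_less_power2_iff:
  includes bit_operations_syntax
  fixes a c b s :: nat
  assumes a: "2 ^ b \<le> a" "a < 2 ^ Suc b" and c: "c < 2 ^ b"
  shows "a XOR c < 2 ^ s \<longleftrightarrow> a < 2 ^ s"
proof -
  have less_iff: "k < 2 ^ t \<longleftrightarrow> take_bit t k = k" for k t :: nat
    by (simp add: take_bit_nat_eq_self_iff)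
  have c_lt: "c < 2 ^ t" if "b \<le> t" for t
    using c that by (meson less_le_trans one_le_numeral power_increasing)
  show ?thesis
  proof (cases "b < s")
    case True
    then have "(2::nat) ^ Suc b \<le> 2 ^ s"
      by (intro power_increasing) auto
    then have "a < 2 ^ s"
      using a by linarith
    moreover have "c < 2 ^ s"
      using c_lt True by simp
    ultimately show ?thesis
      by (simp add: less_iff take_bit_xor)
  next
    case False
    then have "(2::nat) ^ s \<le> 2 ^ b"
      by (intro power_increasing) auto
    \<comment> \<open>Otherwise \<open>a XOR c\<close> and \<open>c\<close> would both fit in
      \<open>b\<close> bits, and XORing them would give back \<open>a\<close>, which does
      not.\<close>
    moreover have "2 ^ b \<le> a XOR c"
    proof (rule ccontr)
      assume "\<not> 2 ^ b \<le> a XOR c"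
      then have "take_bit b ((a XOR c) XOR c) = (a XOR c) XOR c"
        using c by (subst take_bit_xor) (simp only: not_le less_iff)
      then have "a < 2 ^ b"
        by (simp add: less_iff xor.assoc)
      then show False
        using a by simp
    qed
    ultimately show ?thesis
      using a by linarith
  qed
qed

lemma floor_log2_bounds:
  fixes a :: nat
  assumes "a > 0"
  defines "b \<equiv> nat \<lfloor>log 2 (real a)\<rfloor>"
  shows "2 ^ b \<le> a" and "a < 2 ^ Suc b"
proof -
  have "\<lfloor>log 2 (real a)\<rfloor> = int b"
    using assms by (simp add: b_def)
  then have "2 ^ b \<le> a \<and> a < 2 ^ (b + 1)"
    using floor_log_nat_eq_powr_iff[of 2 a b] assms(1) by simp
  then show "2 ^ b \<le> a" "a < 2 ^ Suc b"
    by simp_all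
qed

lemma flip_tilde_less_power2_iff:
  "flip_tilde h \<sigma> x N < 2 ^ s \<longleftrightarrow> h x (\<sigma> (0, 0)) mod N < 2 ^ s"
proof (cases "h x (\<sigma> (0, 0)) mod N > 0")
  case True
  then show ?thesis
    using floor_log2_bounds[OF True]
    by (simp add: flip_tilde_def Let_def xor_less_power2_iff)
next
  case False
  \<comment> \<open>Here \<open>b = 0\<close>, so \<open>c\<close> is a residue modulo 1 and the XOR
    is 0.\<close>
  then show ?thesis
    by (simp add: flip_tilde_def Let_def)
qed

lemma flip_tilde_eq_of_less:
  assumes "s \<le> r" and "flip_tilde h \<sigma> x (2 ^ r) < 2 ^ s"
  shows "flip_tilde h \<sigma> x (2 ^ r) = flip_tilde h \<sigma> x (2 ^ s)"
proof -
  have "h x (\<sigma> (0, 0)) mod 2 ^ r mod 2 ^ s = h x (\<sigma> (0, 0)) mod 2 ^ s"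
    using assms(1) by (simp add: mod_mod_cancel le_imp_power_dvd)
  moreover have "h x (\<sigma> (0, 0)) mod 2 ^ r < 2 ^ s"
    using assms(2) by (simp add: flip_tilde_less_power2_iff)
  ultimately have "h x (\<sigma> (0, 0)) mod 2 ^ r = h x (\<sigma> (0, 0)) mod 2 ^ s"
    by simp
  then show ?thesis
    by (simp add: flip_tilde_def)
qed

text \<open>A candidate \<open>e\<close> is returned only after the test
  \<open>e < 2 ^ (r - 1)\<close> has failed.\<close>

lemma flip_loop_cases:
  "flip_loop h \<sigma> x n r is = flip_tilde h \<sigma> x (2 ^ (r - 1)) \<or> 2 ^ (r - 1) \<le> flip_loop h \<sigma> x n r is"
  by (induction "is") (auto simp: Let_def)

text \<open>With \<open>r\<close> fixed, both loops draw the same candidates. One in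
  \<open>[n, n')\<close> would stop only the loop for \<open>n'\<close>, but with a result that is
  not below \<open>n\<close>.\<close>

lemma flip_loop_monotone:
  assumes "n < n'" and "flip_loop h \<sigma> x n' r is < n"
  shows "flip_loop h \<sigma> x n' r is = flip_loop h \<sigma> x n r is"
  using assms by (induction "is") (auto simp: Let_def split: if_splits)

lemma le_power2_ceiling_log2:
  fixes n :: nat
  assumes "n \<ge> 1"
  shows "n \<le> 2 ^ nat \<lceil>log 2 (real n)\<rceil>"
proof -
  define r where "r = nat \<lceil>log 2 (real n)\<rceil>"
  have "log 2 (real n) \<le> real r"
    unfolding r_def by linarith
  then have "real n \<le> 2 ^ r"
    using assms by (simp add: log_le_iff powr_realpow)
  then have "n \<le> 2 ^ r"
    by (metis of_nat_le_iff of_nat_numeral of_nat_power)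
  then show ?thesis
    by (simp only: r_def)
qed

lemma flip_hash_monotone:
  assumes "1 \<le> n" and "n < n'" and less: "flip_hash h \<sigma> m x n' < n"
  shows "flip_hash h \<sigma> m x n' = flip_hash h \<sigma> m x n"
proof -
  define r where "r = nat \<lceil>log 2 (real n)\<rceil>"
  define r' where "r' = nat \<lceil>log 2 (real n')\<rceil>"
  have n_le: "n \<le> 2 ^ r"
    using assms(1) by (simp add: r_def le_power2_ceiling_log2)
  have "r \<le> r'"
    unfolding r_def r'_def using assms(1,2) by (intro nat_mono ceiling_mono) simp
  have hash_n: "flip_hash h \<sigma> m x n =
      (if flip_tilde h \<sigma> x (2 ^ r) < n then flip_tilde h \<sigma> x (2 ^ r)
       else flip_loop h \<sigma> x n r [1..<m + 1])"
    by (simp add: flip_hash_def r_def Let_def)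
  have hash_n': "flip_hash h \<sigma> m x n' =
      (if flip_tilde h \<sigma> x (2 ^ r') < n' then flip_tilde h \<sigma> x (2 ^ r')
       else flip_loop h \<sigma> x n' r' [1..<m + 1])"
    by (simp add: flip_hash_def r'_def Let_def)
  show ?thesis
  proof (cases "r = r'")
    case True
    \<comment> \<open>Both sizes test the same \<open>flip_tilde\<close> value; if it lay in
      \<open>[n, n')\<close>, it would be the result for \<open>n'\<close>, against
      \<open>less\<close>.\<close>
    then show ?thesis
      using less assms(2) flip_loop_monotone[OF assms(2)]
      unfolding hash_n hash_n' by (auto split: if_splits)
  next
    case False
    then have "r \<le> r' - 1"
      using \<open>r \<le> r'\<close> by simp
    then have "(2::nat) ^ r \<le> 2 ^ (r' - 1)"
      by (intro power_increasing) auto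
    then have "flip_hash h \<sigma> m x n' < 2 ^ (r' - 1)"
      using less n_le by linarith
    \<comment> \<open>Take \<open>k = r'\<close> if the first test succeeds and
      \<open>k = r' - 1\<close> if the loop is entered: its other results are too large.\<close>
    then obtain k where "r \<le> k" and k: "flip_hash h \<sigma> m x n' = flip_tilde h \<sigma> x (2 ^ k)"
      using flip_loop_cases[of h \<sigma> x n' r' "[1..<m + 1]"] \<open>r \<le> r'\<close> \<open>r \<le> r' - 1\<close>
      unfolding hash_n' by (metis not_less)
    then have "flip_hash h \<sigma> m x n' = flip_tilde h \<sigma> x (2 ^ r)"
      using flip_tilde_eq_of_less[OF \<open>r \<le> k\<close>, of h \<sigma> x] less n_le by simp
    \<comment> \<open>This value is below \<open>n\<close>, so size \<open>n\<close> returns it at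
      the first test.\<close>
    then show ?thesis
      using less by (simp add: hash_n)
  qed
qed

theorem theorem2p4:
  fixes X :: "'k set" and S :: "'s set" and q m :: nat
    and h :: "'k \<Rightarrow> 's \<Rightarrow> nat" and \<sigma> :: "nat \<times> nat \<Rightarrow> 's"
  assumes "finite X" and "X \<noteq> {}"
    and "q \<ge> 1"
    and "\<And>x. x \<in> X \<Longrightarrow> h x \<in> S \<rightarrow> {0..<2 ^ q}"
    and "\<sigma> \<in> {0..<q} \<times> {0..m} \<rightarrow> S"
    and "inj_on \<sigma> ({0..<q} \<times> {0..m})"
  shows "\<forall>x\<in>X. \<forall>n\<in>{1..2 ^ q}. \<forall>n'\<in>{1..2 ^ q}.
    n < n' \<longrightarrow> flip_hash h \<sigma> m x n' < n \<longrightarrow> flip_hash h \<sigma> m x n' = flip_hash h \<sigma> m x n"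
  using flip_hash_monotone by (metis atLeastAtMost_iff)

end
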